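(* Let $(E^\ell,\vartheta^\ell,\omega^\ell)$ ($\ell=1,2$) be two strict strongly continuous weak noises over $\mathcal B$. Then their product $(E^1\circledcirc E^2,\vartheta^1\circledcirc\vartheta^2,\omega)$ is strongly continuous, too.
   Context: $\mathcal B$ is a unital $C^*$-algebra. $\mathcal B^a(E)$ is the algebra of adjointable operators on a Hilbert $\mathcal B$-module $E$; $xy^*$ denotes the operator $z\mapsto x\langle y,z\rangle$; $\bar\odot$ is the completed interior tensor product. An $E_0$-semigroup $\vartheta=(\vartheta_t)_{t\ge0}$ on $\mathcal B^a(E)$ is a semigroup of unital $*$-endomorphisms; it is strict if each $\vartheta_t$ is $*$-strongly continuous on bounded subsets; it is strongly continuous if $t\mapsto\vartheta_t(a)x$ is norm continuous for all $a\in\mathcal B^a(E)$, $x\in E$. A strict weak noise is a triple $(E,\vartheta,\omega)$ with $\vartheta$ a strict $E_0$-semigroup on $\mathcal B^a(E)$ and $\omega\in E$ a unit vector such that $\langle\omega,\vartheta_t(\omega b\omega^* )\omega\rangle=b$ for all $b\in\mathcal B$, $t\ge0$; it is strongly continuous if $\vartheta$ is. Associated spatial product system of a strict weak noise: $E_t=\vartheta_t(\omega\omega^* )E$ with left action $b.x_t=\vartheta_t(\omega b\omega^* )x_t$; $x\odot y_t=\vartheta_t(x\omega^* )y_t$ defines a unitary identification $E\bar\odot E_t=E$ with $a\odot\mathrm{id}_{E_t}=\vartheta_t(a)$, restricting to $E_s\bar\odot E_t=E_{s+t}$; $\omega_t:=\omega\in E_t$ is a central unital unit $\omega^\odot$ (i.e.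 $\omega_s\odot\omega_t=\omega_{s+t}$, $b\omega_t=\omega_tb$, $\langle\omega_t,\omega_t\rangle=\mathbf 1$). Product of spatial product systems: $((E^1\circledcirc E^2)^{\bar\odot},\omega^\odot)$ is the (unique) product system of Hilbert $\mathcal B$-$\mathcal B$-modules with central unital unit $\omega^\odot$ containing $({E^\ell}^{\bar\odot},{\omega^\ell}^\odot)$ ($\ell=1,2$) as subsystems with $\omega^1_t=\omega_t=\omega^2_t$, such that elements $x^n_{t_n}\odot\dots\odot x^1_{t_1}$ ($t_n+\dots+t_1=t$, $x^i_{t_i}\in E^1_{t_i}\cup E^2_{t_i}$) are total in $(E^1\circledcirc E^2)_t$ and $\langle x^1,x^2\rangle=\langle x^1,\omega^1_t\rangle\langle\omega^2_t,x^2\rangle$ for $x^\ell\in E^\ell_t$. Product of noises: $(E^1\circledcirc E^2,\vartheta^1\circledcirc\vartheta^2,\omega)$ is the (unique up to unitary equivalence) strict weak noise $(F,\vartheta,\omega)$ such that (1) its associated spatial product system is $((E^1\circledcirc E^2)^{\bar\odot},\omega^\odot)$; (2) $F$ contains $E^1,E^2$ as submodules (with $\omega^\ell$ identified with $\omega$, and compatibly with the factorizations $E^\ell=E^\ell\bar\odot E^\ell_t$, $F=F\bar\odot(E^1\circledcirc E^2)_t$) with $\langle x^1,x^2\rangle=\langle x^1,\omega\rangle\langle\omega,x^2\rangle$ for $x^\ell\in E^\ell$; (3) the elements $x^\ell\odot y_t$ ($\ell=1,2$, $x^\ell\in E^\ell$, $t\ge0$, $y_t\in(E^1\circledcirc E^2)_t$)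 are total in $F$. Concretely, with $\widehat E^\ell=E^\ell\ominus\omega^\ell\mathcal B$ and $\breve G=\omega\mathcal B\oplus\widehat E^1\oplus\widehat E^2$, $F$ is the completed inductive limit over $t$ of $\breve G\bar\odot(E^1\circledcirc E^2)_t$, and $\vartheta_t(a)=a\odot\mathrm{id}_{(E^1\circledcirc E^2)_t}$. *)

theory Defs
  imports "HOL-Analysis.Analysis"
begin

section \<open>Complex Banach spaces and unital \<open>C\<^sup>*\<close>-algebras\<close>

class complex_vector = real_vector +
  fixes scaleC :: "complex \<Rightarrow> 'a \<Rightarrow> 'a"  (infixr \<open>*\<^sub>C\<close> 75)
  assumes scaleC_add_right: "c *\<^sub>C (x + y) = c *\<^sub>C x + c *\<^sub>C y"
    and scaleC_add_left: "(c + d) *\<^sub>C x = c *\<^sub>C x + d *\<^sub>C x"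
    and scaleC_scaleC: "c *\<^sub>C d *\<^sub>C x = (c * d) *\<^sub>C x"
    and scaleR_scaleC: "r *\<^sub>R x = complex_of_real r *\<^sub>C x"

interpretation complex_vector:
  vector_space "scaleC :: complex \<Rightarrow> 'a \<Rightarrow> 'a::complex_vector"
proof
  show "1 *\<^sub>C x = x" for x :: 'a
    using scaleR_scaleC[of 1 x] by simp
qed (fact scaleC_add_right scaleC_add_left scaleC_scaleC)+

class complex_normed_vector = complex_vector + real_normed_vector +
  assumes norm_scaleC: "norm (c *\<^sub>C x) = cmod c * norm x"

class complex_banach = complex_normed_vector + banach

text \<open>The zero algebra is admitted, so \<open>real_normed_algebra_1\<close> is not used here.
  If \<open>1 \<noteq> 0\<close>, then \<open>norm 1 = 1\<close> follows from the \<open>C\<^sup>*\<close>-identity.\<close>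

class unital_cstar_algebra = complex_banach + real_normed_algebra + monoid_mult +
  fixes star :: "'a \<Rightarrow> 'a"
  assumes mult_scaleC_left: "(c *\<^sub>C a) * b = c *\<^sub>C (a * b)"
    and mult_scaleC_right: "a * (c *\<^sub>C b) = c *\<^sub>C (a * b)"
    and star_add: "star (a + b) = star a + star b"
    and star_scaleC: "star (c *\<^sub>C a) = cnj c *\<^sub>C star a"
    and star_mult: "star (a * b) = star b * star a"
    and star_star: "star (star a) = a"
    and cstar_identity: "norm (star a * a) = (norm a)\<^sup>2"

definition positive_elem :: "'b::unital_cstar_algebra \<Rightarrow> bool" where
  "positive_elem a \<longleftrightarrow> (\<exists>b. a = star b * b)"


section \<open>Hilbert modules and adjointable operators\<close>

record ('b, 'e) hilbert_module_data =
  rmul :: "'e \<Rightarrow> 'b \<Rightarrow> 'e"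
  ip :: "'e \<Rightarrow> 'e \<Rightarrow> 'b"

text \<open>The Banach space norm of the type \<open>'e\<close> is required to be the module norm;
  completeness of the module is therefore part of the class \<open>complex_banach\<close>.\<close>

locale hilbert_module =
  fixes M :: "('b::unital_cstar_algebra, 'e::complex_banach, 'm) hilbert_module_data_scheme"
  assumes rmul_add_left: "rmul M (x + y) b = rmul M x b + rmul M y b"
    and rmul_add_right: "rmul M x (b + c) = rmul M x b + rmul M x c"
    and rmul_rmul: "rmul M (rmul M x b) c = rmul M x (b * c)"
    and rmul_one: "rmul M x 1 = x"
    and rmul_scaleC_left: "rmul M (d *\<^sub>C x) b = d *\<^sub>C rmul M x b"
    and rmul_scaleC_right: "rmul M x (d *\<^sub>C b) = d *\<^sub>C rmul M x b"
    and ip_add_right: "ip M x (y + z) = ip M x y + ip M x z"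
    and ip_rmul_right: "ip M x (rmul M y b) = ip M x y * b"
    and star_ip: "star (ip M x y) = ip M y x"
    and ip_positive: "positive_elem (ip M x x)"
    and norm_ip: "(norm x)\<^sup>2 = norm (ip M x x)"

definition is_adjoint ::
  "('b, 'e, 'm) hilbert_module_data_scheme \<Rightarrow> ('e \<Rightarrow> 'e) \<Rightarrow> ('e \<Rightarrow> 'e) \<Rightarrow> bool" where
  "is_adjoint M a a' \<longleftrightarrow> (\<forall>x y. ip M (a x) y = ip M x (a' y))"

definition adjointables :: "('b, 'e, 'm) hilbert_module_data_scheme \<Rightarrow> ('e \<Rightarrow> 'e) set" where
  "adjointables M = {a. \<exists>a'. is_adjoint M a a'}"

definition adj :: "('b, 'e, 'm) hilbert_module_data_scheme \<Rightarrow> ('e \<Rightarrow> 'e) \<Rightarrow> 'e \<Rightarrow> 'e" where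
  "adj M a = (THE a'. is_adjoint M a a')"

text \<open>The operator \<open>x y\<^sup>*\<close>.\<close>

definition rank_one :: "('b, 'e, 'm) hilbert_module_data_scheme \<Rightarrow> 'e \<Rightarrow> 'e \<Rightarrow> 'e \<Rightarrow> 'e" where
  "rank_one M x y = (\<lambda>z. rmul M x (ip M y z))"

text \<open>The topology generated by the maps \<open>a \<mapsto> a x\<close> and \<open>a \<mapsto> a\<^sup>* x\<close>: the topology of the
  function type \<open>'e \<Rightarrow> 'e\<close> is that of pointwise norm convergence.\<close>

definition star_strong_topology ::
  "('b, 'e::topological_space, 'm) hilbert_module_data_scheme \<Rightarrow> ('e \<Rightarrow> 'e) topology" where
  "star_strong_topology M = pullback_topology (adjointables M) (\<lambda>a. (a, adj M a)) euclidean"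


section \<open>Weak noises\<close>

record ('b, 'e) noise_data = "('b, 'e) hilbert_module_data" +
  flow :: "real \<Rightarrow> ('e \<Rightarrow> 'e) \<Rightarrow> 'e \<Rightarrow> 'e"
  vac :: 'e

definition unital_star_endomorphism ::
  "('b, 'e::complex_vector, 'm) hilbert_module_data_scheme \<Rightarrow> (('e \<Rightarrow> 'e) \<Rightarrow> 'e \<Rightarrow> 'e) \<Rightarrow> bool"
where
  "unital_star_endomorphism M T \<longleftrightarrow>
    (\<forall>a\<in>adjointables M. T a \<in> adjointables M) \<and>
    (\<forall>a\<in>adjointables M. \<forall>b\<in>adjointables M. T (\<lambda>x. a x + b x) = (\<lambda>x. T a x + T b x)) \<and>
    (\<forall>a\<in>adjointables M. \<forall>c. T (\<lambda>x. c *\<^sub>C a x) = (\<lambda>x. c *\<^sub>C T a x)) \<and>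
    (\<forall>a\<in>adjointables M. \<forall>b\<in>adjointables M. T (a \<circ> b) = T a \<circ> T b) \<and>
    (\<forall>a\<in>adjointables M. T (adj M a) = adj M (T a)) \<and>
    T id = id"

text \<open>\<open>flow N t\<close> is only meaningful for \<open>t \<ge> 0\<close> and on adjointable operators.\<close>

locale strict_weak_noise = hilbert_module N
  for N :: "('b::unital_cstar_algebra, 'e::complex_banach) noise_data" +
  assumes flow_endomorphism: "t \<ge> 0 \<Longrightarrow> unital_star_endomorphism N (flow N t)"
    and flow_zero: "a \<in> adjointables N \<Longrightarrow> flow N 0 a = a"
    and flow_add: "s \<ge> 0 \<Longrightarrow> t \<ge> 0 \<Longrightarrow> a \<in> adjointables N \<Longrightarrow>
      flow N (s + t) a = flow N s (flow N t a)"
    and flow_strict: "t \<ge> 0 \<Longrightarrow> S \<subseteq> adjointables N \<Longrightarrow> (\<exists>r. \<forall>a\<in>S. onorm a \<le> r) \<Longrightarrow>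
      continuous_map (subtopology (star_strong_topology N) S) (star_strong_topology N) (flow N t)"
    and vac_unit: "ip N (vac N) (vac N) = 1"
    and vac_flow: "t \<ge> 0 \<Longrightarrow>
      ip N (vac N) (flow N t (rank_one N (rmul N (vac N) b) (vac N)) (vac N)) = b"

definition strongly_continuous :: "('b, 'e::topological_space) noise_data \<Rightarrow> bool" where
  "strongly_continuous N \<longleftrightarrow>
    (\<forall>a\<in>adjointables N. \<forall>x. continuous_on {0..} (\<lambda>t. flow N t a x))"


section \<open>The associated spatial product system\<close>

text \<open>All fibres are submodules of the module of the noise, and \<open>vac N\<close>, viewed as an element of
  each fibre, is the reference unit. \<open>odot N t x y\<close> is \<open>x \<odot> y\<^sub>t\<close>; it describes both
  identifications, of the module with itself tensored with the fibre at \<open>t\<close>, and (for \<open>x\<close> in the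
  fibre at \<open>s\<close>) of the tensor product of two fibres with the fibre at \<open>s + t\<close>.\<close>

definition fibre :: "('b, 'e) noise_data \<Rightarrow> real \<Rightarrow> 'e set" where
  "fibre N t = range (flow N t (rank_one N (vac N) (vac N)))"

definition lmul :: "('b, 'e) noise_data \<Rightarrow> real \<Rightarrow> 'b \<Rightarrow> 'e \<Rightarrow> 'e" where
  "lmul N t b y = flow N t (rank_one N (rmul N (vac N) b) (vac N)) y"

definition odot :: "('b, 'e) noise_data \<Rightarrow> real \<Rightarrow> 'e \<Rightarrow> 'e \<Rightarrow> 'e" where
  "odot N t x y = flow N t (rank_one N x (vac N)) y"


section \<open>Products\<close>

definition module_isometry_on ::
  "('b, 'e::ab_group_add, 'm) hilbert_module_data_scheme \<Rightarrow>
   ('b, 'f::ab_group_add, 'n) hilbert_module_data_scheme \<Rightarrow> 'e set \<Rightarrow> ('e \<Rightarrow> 'f) \<Rightarrow> bool" where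
  "module_isometry_on M M' X f \<longleftrightarrow>
    (\<forall>x\<in>X. \<forall>y\<in>X. f (x + y) = f x + f y) \<and>
    (\<forall>x\<in>X. \<forall>b. f (rmul M x b) = rmul M' (f x) b) \<and>
    (\<forall>x\<in>X. \<forall>y\<in>X. ip M' (f x) (f y) = ip M x y)"

text \<open>The maps \<open>j t\<close> realize the associated spatial product system of \<open>N'\<close> as a subsystem of that
  of \<open>N\<close>, with the same reference unit.\<close>

definition subsystem_embedding ::
  "('b, 'e::ab_group_add) noise_data \<Rightarrow> ('b, 'f::ab_group_add) noise_data \<Rightarrow>
   (real \<Rightarrow> 'e \<Rightarrow> 'f) \<Rightarrow> bool" where
  "subsystem_embedding N' N j \<longleftrightarrow>
    (\<forall>t\<ge>0. j t ` fibre N' t \<subseteq> fibre N t \<and>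
      module_isometry_on N' N (fibre N' t) (j t) \<and>
      (\<forall>b. \<forall>y\<in>fibre N' t. j t (lmul N' t b y) = lmul N t b (j t y)) \<and>
      j t (vac N') = vac N) \<and>
    (\<forall>s\<ge>0. \<forall>t\<ge>0. \<forall>x\<in>fibre N' s. \<forall>y\<in>fibre N' t.
      j (s + t) (odot N' t x y) = odot N t (j s x) (j t y))"

text \<open>For a family \<open>G\<close> of subsets of the fibres, \<open>is_word N G t x\<close> says that \<open>x\<close> is of the form
  \<open>x\<^sub>n \<odot> \<dots> \<odot> x\<^sub>1\<close> (\<open>n \<ge> 1\<close>) with \<open>x\<^sub>i \<in> G t\<^sub>i\<close>, \<open>t\<^sub>i \<ge> 0\<close> and \<open>t\<^sub>n + \<dots> + t\<^sub>1 = t\<close>.\<close>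

inductive is_word :: "('b, 'f) noise_data \<Rightarrow> (real \<Rightarrow> 'f set) \<Rightarrow> real \<Rightarrow> 'f \<Rightarrow> bool"
  for N :: "('b, 'f) noise_data" and G :: "real \<Rightarrow> 'f set" where
  single: "t \<ge> 0 \<Longrightarrow> x \<in> G t \<Longrightarrow> is_word N G t x"
| snoc: "is_word N G s x \<Longrightarrow> t \<ge> 0 \<Longrightarrow> y \<in> G t \<Longrightarrow> is_word N G (s + t) (odot N t x y)"

text \<open>The associated spatial product system of \<open>N\<close> is the product of those of \<open>N1\<close> and \<open>N2\<close>,
  the latter being contained in it via \<open>j1\<close> and \<open>j2\<close>. Totality refers to the complex linear span.\<close>

definition is_product_system ::
  "('b::unital_cstar_algebra, 'e1::complex_banach) noise_data \<Rightarrow>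
   ('b, 'e2::complex_banach) noise_data \<Rightarrow> ('b, 'f::complex_banach) noise_data \<Rightarrow>
   (real \<Rightarrow> 'e1 \<Rightarrow> 'f) \<Rightarrow> (real \<Rightarrow> 'e2 \<Rightarrow> 'f) \<Rightarrow> bool" where
  "is_product_system N1 N2 N j1 j2 \<longleftrightarrow>
    subsystem_embedding N1 N j1 \<and>
    subsystem_embedding N2 N j2 \<and>
    (\<forall>t\<ge>0. closure (complex_vector.span
        {x. is_word N (\<lambda>s. j1 s ` fibre N1 s \<union> j2 s ` fibre N2 s) t x}) = fibre N t) \<and>
    (\<forall>t\<ge>0. \<forall>x1\<in>fibre N1 t. \<forall>x2\<in>fibre N2 t.
      ip N (j1 t x1) (j2 t x2) = ip N1 x1 (vac N1) * ip N2 (vac N2) x2)"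

text \<open>\<open>i\<close> realizes the module of \<open>N'\<close> as a submodule of that of \<open>N\<close>, compatibly with the
  factorizations and the embedding \<open>j\<close> of the product systems.\<close>

definition noise_embedding ::
  "('b, 'e::ab_group_add) noise_data \<Rightarrow> ('b, 'f::ab_group_add) noise_data \<Rightarrow>
   (real \<Rightarrow> 'e \<Rightarrow> 'f) \<Rightarrow> ('e \<Rightarrow> 'f) \<Rightarrow> bool" where
  "noise_embedding N' N j i \<longleftrightarrow>
    module_isometry_on N' N UNIV i \<and>
    i (vac N') = vac N \<and>
    (\<forall>t\<ge>0. \<forall>x. \<forall>y\<in>fibre N' t. i (odot N' t x y) = odot N t (i x) (j t y))"

text \<open>The product of two noises is determined only up to unitary equivalence;
  \<open>is_noise_product N1 N2 N\<close> says that \<open>N\<close> is a product of \<open>N1\<close> and \<open>N2\<close>.\<close>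

definition is_noise_product ::
  "('b::unital_cstar_algebra, 'e1::complex_banach) noise_data \<Rightarrow>
   ('b, 'e2::complex_banach) noise_data \<Rightarrow> ('b, 'f::complex_banach) noise_data \<Rightarrow> bool" where
  "is_noise_product N1 N2 N \<longleftrightarrow>
    strict_weak_noise N \<and>
    (\<exists>j1 j2 i1 i2.
      is_product_system N1 N2 N j1 j2 \<and>
      noise_embedding N1 N j1 i1 \<and>
      noise_embedding N2 N j2 i2 \<and>
      (\<forall>x1 x2. ip N (i1 x1) (i2 x2) = ip N1 x1 (vac N1) * ip N2 (vac N2) x2) \<and>
      closure (complex_vector.span
        {odot N t x y | t x y. t \<ge> 0 \<and> x \<in> range i1 \<union> range i2 \<and> y \<in> fibre N t}) = UNIV)"

end

theory Submission
  imports Defs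
begin

text \<open>
  Let \<open>V\<^sub>h x = x \<odot> \<omega>\<^sub>h = \<vartheta>\<^sub>h(x\<omega>\<^sup>*)\<omega>\<close> be the shift by the vacuum of a weak noise. Invariance of the
  vacuum makes \<open>V\<^sub>h\<close> isometric (\<open>ip_shift\<close>), and \<open>\<vartheta>\<^sub>h(a)V\<^sub>h = V\<^sub>ha\<close> by multiplicativity of \<open>\<vartheta>\<^sub>h\<close>
  (\<open>flow_odot\<close>). Strong continuity of the noise is equivalent to \<open>V\<^sub>hx \<rightarrow> x\<close> as \<open>h \<rightarrow> 0\<close> for all
  \<open>x\<close>. One direction is immediate from \<open>V\<^sub>hx = \<vartheta>\<^sub>h(x\<omega>\<^sup>*)\<omega>\<close>. For the other, put \<open>h = \<bar>t - s\<bar>\<close>; the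
  two properties of \<open>V\<^sub>h\<close> control \<open>\<vartheta>\<^sub>t(a)x - \<vartheta>\<^sub>s(a)x\<close> by \<open>V\<^sub>hx - x\<close> and \<open>V\<^sub>hz - z\<close>, where
  \<open>z = \<vartheta>\<^sub>s(a)x\<close>, no matter which of \<open>s\<close> and \<open>t\<close> is larger (\<open>norm_flow_diff_le\<close>).

  It remains to see that in the product every vector \<open>x\<close> satisfies \<open>V\<^sub>hx \<rightarrow> x\<close>. These vectors form a
  closed subspace. It contains the two factors, because the embeddings of the factors commute with
  the shifts. It is also closed under \<open>(x, y) \<mapsto> x \<odot> y\<close> for \<open>y\<close> in the fibre at \<open>s\<close>
  (\<open>shift_continuous_odot\<close>): in the fibre at \<open>s + h\<close> the vector \<open>V\<^sub>hy = y \<odot> \<omega>\<^sub>h\<close> is close to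
  \<open>y = \<omega>\<^sub>h \<odot> y\<close>, so that \<open>V\<^sub>h(x \<odot> y) = x \<odot> (y \<odot> \<omega>\<^sub>h)\<close> is close to
  \<open>x \<odot> (\<omega>\<^sub>h \<odot> y) = V\<^sub>hx \<odot> y\<close>, hence to \<open>x \<odot> y\<close>. So it contains the words in elements of the fibres of
  the factors, then the fibres of the product, which the words generate, and then the products
  \<open>x \<odot> y\<close> that are total in the whole module.

  These estimates need a bound on \<open>\<vartheta>\<^sub>t(a)\<close> that is uniform in \<open>t\<close>. Unital \<open>\<^sup>*\<close>-endomorphisms are
  contractive, but a bound up to a constant is enough, and it has a proof free of spectral theory and
  of the order of the coefficient algebra: a small self-adjoint operator is half the sum of two
  unitaries (\<open>half_sum_of_unitaries\<close>), and endomorphisms preserve unitaries.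
\<close>

section \<open>Hilbert modules\<close>

lemma norm_star:
  fixes a :: "'b::unital_cstar_algebra"
  shows "norm (star a) = norm a"
proof -
  have le: "norm c \<le> norm (star c)" for c :: 'b
  proof (cases "c = 0")
    case False
    have "norm c * norm c = norm (star c * c)"
      by (simp add: cstar_identity power2_eq_square)
    also have "\<dots> \<le> norm (star c) * norm c"
      by (rule norm_mult_ineq)
    finally show ?thesis
      using False by simp
  qed simp
  show ?thesis
    using le[of a] le[of "star a"] by (simp add: star_star)
qed

context hilbert_module
begin

lemma ip_scaleC_right: "ip M x (c *\<^sub>C y) = c *\<^sub>C ip M x y"
proof -
  have "ip M x (c *\<^sub>C y) = ip M x (rmul M y (c *\<^sub>C 1))"
    by (simp add: rmul_scaleC_right rmul_one)
  then show ?thesis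
    by (simp add: ip_rmul_right mult_scaleC_right)
qed

lemma ip_add_left: "ip M (x + y) z = ip M x z + ip M y z"
  using star_ip[of z "x + y"] by (simp add: ip_add_right star_add star_ip)

lemma ip_scaleC_left: "ip M (c *\<^sub>C x) y = cnj c *\<^sub>C ip M x y"
  using star_ip[of y "c *\<^sub>C x"] by (simp add: ip_scaleC_right star_scaleC star_ip)

lemma ip_rmul_left: "ip M (rmul M x b) y = star b * ip M x y"
  using star_ip[of y "rmul M x b"] by (simp add: ip_rmul_right star_mult star_ip)

lemma ip_diff_right: "ip M x (y - z) = ip M x y - ip M x z"
  using ip_add_right[of x "y - z" z] by (simp add: algebra_simps)

lemma ip_diff_left: "ip M (x - y) z = ip M x z - ip M y z"
  using ip_add_left[of "x - y" y z] by (simp add: algebra_simps)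

text \<open>By polarization \<open>4\<langle>x, y\<rangle>\<close> is a combination, with coefficients of modulus one, of
  four squares \<open>\<langle>x + cy, x + cy\<rangle>\<close> with \<open>\<bar>c\<bar> = 1\<close>, whose norms the triangle inequality bounds.
  The Cauchy-Schwarz inequality has the constant \<open>1\<close> but rests on the order of the
  coefficient algebra.\<close>

lemma norm_ip_le: "norm (ip M x y) \<le> 4 * norm x * norm y"
proof -
  have unit: "norm (ip M u v) \<le> 4" if u: "norm u \<le> 1" and v: "norm v \<le> 1" for u v
  proof -
    define q where "q c = ip M (u + c *\<^sub>C v) (u + c *\<^sub>C v)" for c
    have q: "q c = ip M u u + c *\<^sub>C ip M u v + cnj c *\<^sub>C ip M v u + (cnj c * c) *\<^sub>C ip M v v" for c
      by (simp add: q_def ip_add_left ip_add_right ip_scaleC_left ip_scaleC_right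
        scaleC_add_right scaleC_scaleC algebra_simps)
    have q_le: "norm (cnj c *\<^sub>C q c) \<le> 4" if "cmod c = 1" for c
    proof -
      have "norm (u + c *\<^sub>C v) \<le> 2"
        using norm_triangle_ineq[of u "c *\<^sub>C v"] u v that by (simp add: norm_scaleC)
      then have "(norm (u + c *\<^sub>C v))\<^sup>2 \<le> 2\<^sup>2"
        by (rule power_mono) simp
      then show ?thesis
        using that by (simp add: q_def norm_scaleC flip: norm_ip)
    qed
    have "4 *\<^sub>C ip M u v = 1 *\<^sub>C q 1 + (-1) *\<^sub>C q (-1) + cnj \<i> *\<^sub>C q \<i> + cnj (-\<i>) *\<^sub>C q (-\<i>)"
    proof -
      have "(4::complex) = 1 + 1 + 1 + 1" by simp
      then have "4 *\<^sub>C ip M u v = ip M u v + ip M u v + ip M u v + ip M u v"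
        by (simp only: scaleC_add_left complex_vector.scale_one)
      then show ?thesis
        by (simp add: q scaleC_add_right scaleC_scaleC complex_vector.scale_right_diff_distrib)
    qed
    then have "norm (4 *\<^sub>C ip M u v)
        \<le> norm (1 *\<^sub>C q 1) + norm ((-1) *\<^sub>C q (-1)) + norm (cnj \<i> *\<^sub>C q \<i>) + norm (cnj (-\<i>) *\<^sub>C q (-\<i>))"
      by (simp only:) (intro norm_triangle_le add_mono order_refl)
    also have "\<dots> \<le> 4 + 4 + 4 + 4"
      using q_le[of 1] q_le[of "-1"] q_le[of \<i>] q_le[of "-\<i>"] by (intro add_mono) simp_all
    finally show ?thesis
      by (simp add: norm_scaleC)
  qed
  show ?thesis
  proof (cases "x = 0 \<or> y = 0")
    case True
    then show ?thesis
      using ip_diff_left[of 0 0 y] ip_diff_right[of x 0 0] by auto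
  next
    case False
    let ?a = "complex_of_real (inverse (norm x))" and ?b = "complex_of_real (inverse (norm y))"
    have "norm (ip M (?a *\<^sub>C x) (?b *\<^sub>C y)) \<le> 4"
      using False by (intro unit) (simp_all add: norm_scaleC norm_inverse)
    then show ?thesis
      using False
      by (simp add: ip_scaleC_left ip_scaleC_right norm_scaleC norm_inverse norm_mult norm_divide field_simps)
  qed
qed

lemma bounded_bilinear_ip: "bounded_bilinear (ip M)"
proof
  show "\<exists>K. \<forall>x y. norm (ip M x y) \<le> norm x * norm y * K"
    using norm_ip_le by (intro exI[of _ 4]) (simp add: mult.commute mult.left_commute)
qed (simp_all add: ip_add_left ip_add_right scaleR_scaleC ip_scaleC_left ip_scaleC_right)

lemma norm_rmul_le: "norm (rmul M x b) \<le> norm x * norm b"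
proof -
  have "(norm (rmul M x b))\<^sup>2 = norm (star b * (ip M x x * b))"
    by (simp add: norm_ip ip_rmul_left ip_rmul_right mult.assoc)
  also have "\<dots> \<le> norm (star b) * (norm (ip M x x) * norm b)"
    by (meson norm_mult_ineq order_trans mult_left_mono norm_ge_zero)
  also have "\<dots> = (norm x * norm b)\<^sup>2"
    by (simp add: norm_star norm_ip[symmetric] power2_eq_square)
  finally show ?thesis
    by (rule power2_le_imp_le) simp
qed

lemma ip_self_eq_0: "ip M x x = 0 \<Longrightarrow> x = 0"
  using norm_ip[of x] by simp

lemma ip_cancel_right:
  assumes "\<And>z. ip M z x = ip M z y"
  shows "x = y"
  using assms[of "x - y"] ip_self_eq_0[of "x - y"] by (simp add: ip_diff_right)

lemma is_adjoint_sym: "is_adjoint M a a' \<Longrightarrow> is_adjoint M a' a"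
  unfolding is_adjoint_def by (metis star_ip)

lemma adj_eq: "is_adjoint M a a' \<Longrightarrow> adj M a = a'"
  unfolding adj_def is_adjoint_def
  by (intro the_equality) (simp, metis ext ip_cancel_right)

lemma is_adjoint_adj: "a \<in> adjointables M \<Longrightarrow> is_adjoint M a (adj M a)"
  using adj_eq unfolding adjointables_def by blast

lemma adjointableI: "is_adjoint M a a' \<Longrightarrow> a \<in> adjointables M"
  unfolding adjointables_def by blast

lemma is_adjoint_compose:
  "is_adjoint M a a' \<Longrightarrow> is_adjoint M b b' \<Longrightarrow> is_adjoint M (a \<circ> b) (b' \<circ> a')"
  unfolding is_adjoint_def by simp

lemma is_adjoint_add:
  "is_adjoint M a a' \<Longrightarrow> is_adjoint M b b' \<Longrightarrow> is_adjoint M (\<lambda>x. a x + b x) (\<lambda>x. a' x + b' x)"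
  unfolding is_adjoint_def by (simp add: ip_add_left ip_add_right)

lemma is_adjoint_scaleC:
  "is_adjoint M a a' \<Longrightarrow> is_adjoint M (\<lambda>x. c *\<^sub>C a x) (\<lambda>x. cnj c *\<^sub>C a' x)"
  unfolding is_adjoint_def by (simp add: ip_scaleC_left ip_scaleC_right)

lemma is_adjoint_rank_one: "is_adjoint M (rank_one M x y) (rank_one M y x)"
  unfolding is_adjoint_def rank_one_def by (simp add: ip_rmul_left ip_rmul_right star_ip)

lemma rank_one_adjointable: "rank_one M x y \<in> adjointables M"
  using is_adjoint_rank_one by (rule adjointableI)

lemma adj_adjointable: "a \<in> adjointables M \<Longrightarrow> adj M a \<in> adjointables M"
  using is_adjoint_adj is_adjoint_sym adjointableI by blast

lemma adjointable_rmul: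
  assumes "a \<in> adjointables M"
  shows "a (rmul M x b) = rmul M (a x) b"
proof -
  obtain a' where "is_adjoint M a' a"
    using assms is_adjoint_adj is_adjoint_sym by blast
  then have [simp]: "\<And>z y. ip M z (a y) = ip M (a' z) y"
    by (simp add: is_adjoint_def)
  show ?thesis
    by (rule ip_cancel_right) (simp add: ip_rmul_right)
qed

lemma adjointable_scaleC:
  assumes "a \<in> adjointables M"
  shows "a (c *\<^sub>C x) = c *\<^sub>C a x"
  using adjointable_rmul[OF assms, of x "c *\<^sub>C 1"] by (simp add: rmul_scaleC_right rmul_one)

text \<open>The operator \<open>a\<close> is bounded on each of the sets \<open>A n\<close> below, which are closed although
  \<open>a\<close> is not yet known to be continuous: they are defined by the continuous functionals
  \<open>\<langle>a\<^sup>*y, \<sqdot>\<rangle>\<close>. By Baire's theorem one of them contains a ball.\<close>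

lemma adjointable_bounded_linear:
  assumes a: "a \<in> adjointables M"
  shows "bounded_linear a"
proof -
  obtain a' where a': "is_adjoint M a' a"
    using a is_adjoint_adj is_adjoint_sym by blast
  then have ip_a: "ip M z (a y) = ip M (a' z) y" for z y
    by (simp add: is_adjoint_def)
  have add: "a (x + y) = a x + a y" for x y
    by (rule ip_cancel_right) (simp add: ip_add_right ip_a)
  have scaleR: "a (r *\<^sub>R x) = r *\<^sub>R a x" for r x
    by (simp add: scaleR_scaleC adjointable_scaleC[OF a])
  define A where "A n = (\<Inter>y. {x. norm (ip M (a' y) x) \<le> real n * norm y})" for n
  have closed_A: "closed (A n)" for n
    unfolding A_def
    by (intro closed_INT ballI closed_Collect_le continuous_intros
        bounded_bilinear.continuous_on[OF bounded_bilinear_ip])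
  have A_norm: "norm (a x) \<le> real n" if "x \<in> A n" for x n
  proof (cases "a x = 0")
    case False
    have "norm (a x) * norm (a x) = norm (ip M (a' (a x)) x)"
      using norm_ip[of "a x"] by (simp add: power2_eq_square flip: ip_a)
    also have "\<dots> \<le> real n * norm (a x)"
      using that by (auto simp: A_def)
    finally show ?thesis
      using False by simp
  qed simp
  have A_Union: "(\<Union>n. A n) = UNIV"
  proof -
    have "\<exists>n. x \<in> A n" for x
    proof -
      obtain n :: nat where n: "4 * norm (a x) \<le> real n"
        using real_arch_simple by blast
      have "norm (ip M (a' y) x) \<le> real n * norm y" for y
      proof -
        have "norm (ip M (a' y) x) \<le> 4 * norm y * norm (a x)"
          using norm_ip_le[of y "a x"] by (simp add: ip_a)
        also have "\<dots> \<le> real n * norm y"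
          using mult_right_mono[OF n norm_ge_zero[of y]] by (simp add: algebra_simps)
        finally show ?thesis .
      qed
      then show ?thesis
        by (auto simp: A_def)
    qed
    then show ?thesis by auto
  qed
  have "\<exists>n. interior (A n) \<noteq> {}"
  proof (rule ccontr)
    assume "\<not> ?thesis"
    then have "Met_TC.mtopology interior_of \<Union> (range A) = {}"
      by (intro Met_TC.metric_Baire_category_alt) (auto simp: closed_A complete_UNIV)
    then show False
      by (simp add: A_Union)
  qed
  then obtain n x0 where "x0 \<in> interior (A n)"
    by auto
  then obtain e where e: "e > 0" "cball x0 e \<subseteq> A n"
    by (meson mem_interior_cball)
  have ball: "norm (a y) \<le> 2 * real n" if "norm y \<le> e" for y
  proof -
    have "x0 + y \<in> A n" "x0 \<in> A n"
      using e that by (auto simp: dist_norm)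
    then have "norm (a (x0 + y)) \<le> real n" "norm (a x0) \<le> real n"
      by (simp_all add: A_norm)
    then show ?thesis
      using norm_triangle_ineq4[of "a (x0 + y)" "a x0"] by (simp add: add)
  qed
  show ?thesis
  proof (rule bounded_linear_intro[OF add scaleR])
    show "norm (a x) \<le> norm x * (2 * real n / e)" for x
    proof (cases "x = 0")
      case True
      then show ?thesis using add[of 0 0] by simp
    next
      case False
      have "norm (a ((e / norm x) *\<^sub>R x)) \<le> 2 * real n"
        using False e by (intro ball) simp
      then show ?thesis
        using False e by (simp add: scaleR field_simps)
    qed
  qed
qed

lemma adjointable_bound:
  assumes "a \<in> adjointables M"
  obtains K where "K > 0" "\<And>x. norm (a x) \<le> K * norm x"
  using bounded_linear.pos_bounded[OF adjointable_bounded_linear[OF assms]]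
  by (metis mult.commute)

text \<open>The estimate comes from \<open>\<parallel>a\<^sup>*x\<parallel>\<^sup>2 = \<parallel>\<langle>aa\<^sup>*x, x\<rangle>\<parallel>\<close>.\<close>

lemma norm_adjoint_le:
  assumes "is_adjoint M a a'" and "\<And>x. norm (a x) \<le> C * norm x"
  shows "norm (a' x) \<le> 4 * C * norm x"
proof (cases "a' x = 0")
  case False
  have "norm (a' x) * norm (a' x) = norm (ip M (a (a' x)) x)"
    using assms(1) norm_ip[of "a' x"] by (simp add: is_adjoint_def power2_eq_square)
  also have "\<dots> \<le> 4 * norm (a (a' x)) * norm x"
    by (rule norm_ip_le)
  also have "\<dots> \<le> 4 * (C * norm (a' x)) * norm x"
    by (intro mult_right_mono mult_left_mono assms(2)) auto
  finally have "norm (a' x) * norm (a' x) \<le> (4 * C * norm x) * norm (a' x)"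
    by (simp add: algebra_simps)
  then show ?thesis
    using False by simp
next
  case True
  have "0 \<le> C * norm x"
    using assms(2)[of x] norm_ge_zero order_trans by blast
  then show ?thesis
    using True by simp
qed

section \<open>Unital endomorphisms are bounded\<close>

text \<open>A square root of \<open>1 - b\<^sup>2\<close> is \<open>1 - y\<close>, where \<open>y\<close> solves
  \<open>y = (b\<^sup>2 + y\<^sup>2) / 2\<close>. On the ball of radius \<open>1/2\<close> the right-hand side is a contraction,
  and it preserves the self-adjoint operators that commute with \<open>b\<close>.\<close>

lemma sqrt_one_minus_square:
  assumes b: "is_adjoint M b b" and b_le: "\<And>x. norm (b x) \<le> norm x / 2"
  obtains c where "is_adjoint M c c" "\<And>x. c (c x) = x - b (b x)" "\<And>x. b (c x) = c (b x)"
proof -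
  define B where "B = Blinfun b"
  have B: "blinfun_apply B = b"
    unfolding B_def using b adjointableI
    by (intro bounded_linear_Blinfun_apply adjointable_bounded_linear) blast
  have norm_B: "norm B \<le> 1/2"
    using b_le by (intro norm_blinfun_bound) (simp_all add: B mult.commute)
  define S where "S = {Y. norm Y \<le> 1/2 \<and>
    (\<forall>u v. ip M (blinfun_apply Y u) v = ip M u (blinfun_apply Y v)) \<and>
    (\<forall>u. b (blinfun_apply Y u) = blinfun_apply Y (b u))}"
  define f where "f Y = (1/2) *\<^sub>R ((B o\<^sub>L B) + (Y o\<^sub>L Y))" for Y
  have f_apply: "blinfun_apply (f Y) u = (1/2) *\<^sub>R (b (b u) + Y (Y u))" for Y u
    by (simp add: f_def B blinfun.scaleR_left blinfun.add_left)
  have b_lin: "b (u + v) = b u + b v" "b (r *\<^sub>R u) = r *\<^sub>R b u" for r u v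
    by (simp_all add: blinfun.scaleR_right blinfun.add_right flip: B)
  have "closed S"
    unfolding S_def B[symmetric]
    by (intro closed_Collect_conj closed_Collect_all closed_Collect_le closed_Collect_eq
        continuous_intros bounded_bilinear.continuous_on[OF bounded_bilinear_ip])
  then have "complete S"
    by (simp add: complete_eq_closed)
  moreover have "0 \<in> S"
    using bounded_bilinear.zero_left[OF bounded_bilinear_ip] bounded_bilinear.zero_right[OF bounded_bilinear_ip]
    by (simp add: S_def flip: B)
  moreover have "f ` S \<subseteq> S"
  proof (rule image_subsetI)
    fix Y assume Y: "Y \<in> S"
    have "norm (f Y) \<le> (1/2) * (norm B * norm B + norm Y * norm Y)"
      unfolding f_def norm_scaleR
      by (auto intro!: order_trans[OF norm_triangle_ineq] add_mono norm_blinfun_compose)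
    also have "\<dots> \<le> (1/2) * (1/2 * (1/2) + 1/2 * (1/2))"
      using Y norm_B by (intro mult_left_mono add_mono mult_mono) (auto simp: S_def)
    finally show "f Y \<in> S"
      using Y b by (simp add: S_def f_apply is_adjoint_def ip_add_left ip_add_right b_lin
        blinfun.scaleR_right blinfun.add_right
        bounded_bilinear.scaleR_left[OF bounded_bilinear_ip]
        bounded_bilinear.scaleR_right[OF bounded_bilinear_ip])
  qed
  moreover have "dist (f Y) (f Z) \<le> 1/2 * dist Y Z" if "Y \<in> S" "Z \<in> S" for Y Z
  proof -
    have "f Y - f Z = (1/2) *\<^sub>R ((Y o\<^sub>L (Y - Z)) + ((Y - Z) o\<^sub>L Z))"
      by (rule blinfun_eqI)
        (simp add: f_apply blinfun.scaleR_left blinfun.add_left blinfun.diff_left blinfun.diff_right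
          algebra_simps)
    also have "norm \<dots> \<le> (1/2) * (norm Y * norm (Y - Z) + norm (Y - Z) * norm Z)"
      unfolding norm_scaleR
      by (auto intro!: order_trans[OF norm_triangle_ineq] add_mono norm_blinfun_compose)
    also have "\<dots> \<le> (1/2) * (1/2 * norm (Y - Z) + norm (Y - Z) * (1/2))"
      using that by (intro mult_left_mono add_mono mult_mono) (auto simp: S_def)
    finally show ?thesis
      by (simp add: dist_norm)
  qed
  ultimately obtain Y where Y: "Y \<in> S" and fix_Y: "f Y = Y"
    using Banach_fix[of S "1/2" f] by auto
  have square: "Y (Y u) = 2 *\<^sub>R Y u - b (b u)" for u
  proof -
    have "Y u = (1/2) *\<^sub>R (b (b u) + Y (Y u))"
      by (metis f_apply fix_Y)
    then have "2 *\<^sub>R Y u = b (b u) + Y (Y u)"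
      by (metis div_self scaleR_one scaleR_scaleR times_divide_eq_right mult.right_neutral zero_neq_numeral)
    then show ?thesis by simp
  qed
  show thesis
  proof (rule that[of "\<lambda>x. x - Y x"])
    show "is_adjoint M (\<lambda>x. x - Y x) (\<lambda>x. x - Y x)"
      using Y by (simp add: S_def is_adjoint_def ip_diff_left ip_diff_right)
    show "x - Y x - Y (x - Y x) = x - b (b x)" for x
      by (simp add: blinfun.diff_right square scaleR_2)
    show "b (x - Y x) = b x - Y (b x)" for x
      using Y by (simp add: S_def blinfun.diff_right flip: B)
  qed
qed

text \<open>If \<open>c\<close> is the square root of \<open>1 - b\<^sup>2\<close> constructed above, \<open>b \<plusminus> ic\<close> are unitary because \<open>b\<close> and \<open>c\<close> are commuting
  self-adjoint operators with \<open>b\<^sup>2 + c\<^sup>2 = 1\<close>.\<close>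

lemma half_sum_of_unitaries:
  assumes b: "is_adjoint M b b" and "\<And>x. norm (b x) \<le> norm x / 2"
  obtains u u' where "is_adjoint M u u'" "u \<circ> u' = id" "u' \<circ> u = id"
    "b = (\<lambda>x. (1/2) *\<^sub>C (u x + u' x))"
proof -
  obtain c where c: "is_adjoint M c c" and cc: "\<And>x. c (c x) = x - b (b x)"
      and bc: "\<And>x. b (c x) = c (b x)"
    using sqrt_one_minus_square assms by metis
  have bl: "bounded_linear b" "bounded_linear c"
    using b c adjointableI adjointable_bounded_linear by blast+
  have [simp]: "b (c1 *\<^sub>C x) = c1 *\<^sub>C b x" "c (c1 *\<^sub>C x) = c1 *\<^sub>C c x" for c1 x
    using b c adjointableI adjointable_scaleC by blast+
  have [simp]: "b (x + y) = b x + b y" "c (x + y) = c x + c y"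
      "b (x - y) = b x - b y" "c (x - y) = c x - c y" for x y
    using bl by (simp_all add: linear_simps)
  define u where "u s = (\<lambda>x. b x + s *\<^sub>C c x)" for s
  have "is_adjoint M (u \<i>) (u (-\<i>))"
    using is_adjoint_add[OF b is_adjoint_scaleC[OF c, of \<i>]] by (simp add: u_def)
  moreover have u_unitary: "u s \<circ> u (-s) = id" if "s * s = -1" for s
    using that by (auto simp: u_def fun_eq_iff bc cc scaleC_add_right scaleC_scaleC
      complex_vector.scale_right_diff_distrib)
  then have "u \<i> \<circ> u (-\<i>) = id" "u (-\<i>) \<circ> u \<i> = id"
    using u_unitary[of \<i>] u_unitary[of "-\<i>"] by simp_all
  moreover have "(1/2) *\<^sub>C (u \<i> x + u (-\<i>) x) = b x" for x
    by (simp add: u_def scaleC_add_right scaleC_scaleC flip: scaleC_add_left add.assoc)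
  ultimately show thesis
    using that[of "u \<i>" "u (-\<i>)"] by auto
qed

lemma unitary_isometric:
  assumes "is_adjoint M u u'" "u' \<circ> u = id"
  shows "norm (u x) = norm x"
proof -
  have "ip M (u x) (u x) = ip M x x"
    using assms by (simp add: is_adjoint_def fun_eq_iff)
  then have "(norm (u x))\<^sup>2 = (norm x)\<^sup>2"
    by (simp add: norm_ip)
  then show ?thesis by simp
qed

lemma endomorphism_is_adjoint:
  assumes "unital_star_endomorphism M T" and a: "is_adjoint M a a'"
  shows "is_adjoint M (T a) (T a')"
proof -
  have "T a \<in> adjointables M" "T (adj M a) = adj M (T a)"
    using assms(1) adjointableI[OF a] by (simp_all add: unital_star_endomorphism_def)
  then show ?thesis
    using is_adjoint_adj[of "T a"] adj_eq[OF a] by simp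
qed

text \<open>A unital endomorphism sends unitaries to unitaries, which are isometric. This bounds it
  on small self-adjoint operators, and \<open>\<parallel>T(a)x\<parallel>\<^sup>2 = \<parallel>\<langle>x, T(a\<^sup>*a)x\<rangle>\<parallel>\<close> does the rest. The
  constant is not optimal; what matters is that it does not depend on \<open>T\<close>.\<close>

lemma endomorphism_bound:
  assumes T: "unital_star_endomorphism M T" and a: "a \<in> adjointables M"
    and a_le: "\<And>x. norm (a x) \<le> C * norm x"
  shows "norm (T a x) \<le> 6 * C * norm x"
proof -
  have T_add: "T (\<lambda>x. a x + b x) = (\<lambda>x. T a x + T b x)"
    and T_comp: "T (a \<circ> b) = T a \<circ> T b" if "a \<in> adjointables M" "b \<in> adjointables M" for a b
    using T that by (simp_all add: unital_star_endomorphism_def)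
  have T_scale: "T (\<lambda>x. c *\<^sub>C a x) = (\<lambda>x. c *\<^sub>C T a x)" if "a \<in> adjointables M" for a c
    using T that by (simp add: unital_star_endomorphism_def)
  have T_is_adjoint: "is_adjoint M (T u) (T u')" if "is_adjoint M u u'" for u u'
    using T that by (rule endomorphism_is_adjoint)
  have T_unitary: "norm (T u x) = norm x" if "is_adjoint M u u'" "u' \<circ> u = id" for u u' x
  proof (rule unitary_isometric[OF T_is_adjoint[OF that(1)]])
    have "T (u' \<circ> u) = T u' \<circ> T u"
      using that(1) by (intro T_comp) (auto intro: adjointableI is_adjoint_sym)
    then show "T u' \<circ> T u = id"
      using that(2) T by (simp add: unital_star_endomorphism_def)
  qed
  have small: "norm (T b x) \<le> norm x"
    if b: "is_adjoint M b b" and b_le: "\<And>x. norm (b x) \<le> norm x / 2" for b x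
  proof -
    obtain u u' where u: "is_adjoint M u u'" "u \<circ> u' = id" "u' \<circ> u = id"
      and b_eq: "b = (\<lambda>x. (1/2) *\<^sub>C (u x + u' x))"
      using half_sum_of_unitaries b b_le by blast
    have u': "is_adjoint M u' u"
      using u(1) by (rule is_adjoint_sym)
    have "T b = (\<lambda>x. (1/2) *\<^sub>C (T u x + T u' x))"
      unfolding b_eq T_scale[OF adjointableI[OF is_adjoint_add[OF u(1) u']]]
        T_add[OF adjointableI[OF u(1)] adjointableI[OF u']] ..
    then have "norm (T b x) = (1/2) * norm (T u x + T u' x)"
      by (simp add: norm_scaleC norm_divide)
    also have "\<dots> \<le> (1/2) * (norm x + norm x)"
      using norm_triangle_ineq[of "T u x" "T u' x"] T_unitary u u' by simp
    finally show ?thesis by simp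
  qed
  have selfadjoint: "norm (T b x) \<le> 2 * K * norm x"
    if b: "is_adjoint M b b" and K: "K > 0" and b_le: "\<And>x. norm (b x) \<le> K * norm x" for b K x
  proof -
    \<comment> \<open>The factor \<open>1 / (2K)\<close> brings \<open>b\<close> into the range where it is half a sum of unitaries.\<close>
    let ?c = "complex_of_real (1 / (2 * K))"
    have "norm (T (\<lambda>x. ?c *\<^sub>C b x) x) \<le> norm x"
    proof (rule small)
      show "is_adjoint M (\<lambda>x. ?c *\<^sub>C b x) (\<lambda>x. ?c *\<^sub>C b x)"
        using is_adjoint_scaleC[OF b, of ?c] by simp
      show "norm (?c *\<^sub>C b x) \<le> norm x / 2" for x
        using b_le[of x] K by (simp add: norm_scaleC norm_divide norm_mult field_simps)
    qed
    then show ?thesis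
      using K T_scale[OF adjointableI[OF b], of ?c]
      by (simp add: norm_scaleC norm_divide norm_mult field_simps)
  qed
  have C: "C * norm y \<ge> 0" for y :: 'e
    using a_le[of y] norm_ge_zero order_trans by blast
  show ?thesis
  proof (cases "C > 0")
    case True
    let ?a' = "adj M a"
    have a': "is_adjoint M a ?a'"
      using a by (rule is_adjoint_adj)
    have le: "norm (T (?a' \<circ> a) x) \<le> 2 * (4 * C * C) * norm x"
    proof (rule selfadjoint)
      show "is_adjoint M (?a' \<circ> a) (?a' \<circ> a)"
        using a' is_adjoint_sym is_adjoint_compose by blast
      show "norm ((?a' \<circ> a) y) \<le> (4 * C * C) * norm y" for y
      proof -
        have "norm (?a' (a y)) \<le> 4 * C * norm (a y)"
          by (rule norm_adjoint_le[OF a' a_le])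
        also have "\<dots> \<le> 4 * C * (C * norm y)"
          using True by (intro mult_left_mono a_le) auto
        finally show ?thesis by (simp add: algebra_simps)
      qed
    qed (use True in simp)
    have "ip M (T a x) (T a x) = ip M x (T (?a' \<circ> a) x)"
      using T_is_adjoint[OF a'] T_comp[OF adj_adjointable[OF a] a] by (simp add: is_adjoint_def)
    then have "(norm (T a x))\<^sup>2 \<le> 4 * norm x * norm (T (?a' \<circ> a) x)"
      using norm_ip_le by (simp add: norm_ip)
    also have "\<dots> \<le> 4 * norm x * (2 * (4 * C * C) * norm x)"
      by (intro mult_left_mono le) simp
    also have "\<dots> \<le> (6 * C * norm x)\<^sup>2"
      using True by (simp add: power2_eq_square algebra_simps)
    finally show ?thesis
      using C[of x] by (auto intro: power2_le_imp_le)
  next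
    case False
    \<comment> \<open>A nonpositive \<open>C\<close> forces \<open>a = 0\<close>; if the module is zero, \<open>C\<close> may be negative.\<close>
    have C_0: "C * norm y = 0" for y :: 'e
      using C[of y] False by (meson antisym mult_nonpos_nonneg norm_ge_zero not_less)
    have "a y = 0" for y
      using order_trans[OF a_le[of y] eq_refl[OF C_0]] by simp
    then have "a = (\<lambda>x. 0 *\<^sub>C a x)"
      by auto
    then have "T a x = 0"
      using T_scale[OF a, of 0] by (metis complex_vector.scale_zero_left)
    then show ?thesis
      using C[of x] by simp
  qed
qed

end
section \<open>The shift by the vacuum\<close>

definition shift_continuous :: "('b, 'f::topological_space) noise_data \<Rightarrow> 'f set" where
  "shift_continuous N = {x. ((\<lambda>h. odot N h x (vac N)) \<longlongrightarrow> x) (at_right 0)}"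

context strict_weak_noise
begin

lemma flow_adjointable: "t \<ge> 0 \<Longrightarrow> a \<in> adjointables N \<Longrightarrow> flow N t a \<in> adjointables N"
  using flow_endomorphism by (simp add: unital_star_endomorphism_def)

lemma flow_compose:
  "t \<ge> 0 \<Longrightarrow> a \<in> adjointables N \<Longrightarrow> b \<in> adjointables N \<Longrightarrow>
    flow N t a (flow N t b x) = flow N t (a \<circ> b) x"
  using flow_endomorphism by (simp add: unital_star_endomorphism_def)

lemma flow_is_adjoint:
  "t \<ge> 0 \<Longrightarrow> is_adjoint N a a' \<Longrightarrow> is_adjoint N (flow N t a) (flow N t a')"
  using flow_endomorphism by (rule endomorphism_is_adjoint)

lemma flow_odot:
  assumes "t \<ge> 0" "a \<in> adjointables N"
  shows "flow N t a (odot N t x y) = odot N t (a x) y"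
proof -
  have "a \<circ> rank_one N x (vac N) = rank_one N (a x) (vac N)"
    using assms by (auto simp: rank_one_def adjointable_rmul)
  then show ?thesis
    using assms by (simp add: odot_def flow_compose rank_one_adjointable)
qed

lemma odot_assoc:
  assumes "s \<ge> 0" "t \<ge> 0"
  shows "odot N t (odot N s x y) z = odot N (s + t) x (odot N t y z)"
  using flow_odot[OF assms(2) flow_adjointable[OF assms(1) rank_one_adjointable], of x "vac N" y z]
    flow_add[OF assms(2,1) rank_one_adjointable]
  by (simp add: odot_def add.commute)

lemma norm_odot_le:
  assumes "t \<ge> 0"
  shows "norm (odot N t x y) \<le> norm x * norm y * (24 * norm (vac N))"
proof -
  have "norm (odot N t x y) \<le> 6 * (4 * norm x * norm (vac N)) * norm y"
    unfolding odot_def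
  proof (rule endomorphism_bound[OF flow_endomorphism[OF assms] rank_one_adjointable])
    fix z
    have "norm (rank_one N x (vac N) z) \<le> norm x * norm (ip N (vac N) z)"
      unfolding rank_one_def by (rule norm_rmul_le)
    also have "\<dots> \<le> norm x * (4 * norm (vac N) * norm z)"
      by (intro mult_left_mono norm_ip_le) simp
    finally show "norm (rank_one N x (vac N) z) \<le> 4 * norm x * norm (vac N) * norm z"
      by (simp add: algebra_simps)
  qed
  then show ?thesis
    by (simp add: algebra_simps)
qed

lemma odot_add_left:
  assumes "t \<ge> 0"
  shows "odot N t (x + x') y = odot N t x y + odot N t x' y"
proof -
  have "rank_one N (x + x') (vac N) = (\<lambda>z. rank_one N x (vac N) z + rank_one N x' (vac N) z)"
    by (simp add: rank_one_def rmul_add_left)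
  then show ?thesis
    using flow_endomorphism[OF assms] rank_one_adjointable
    by (simp add: odot_def unital_star_endomorphism_def)
qed

lemma odot_scaleC_left:
  assumes "t \<ge> 0"
  shows "odot N t (c *\<^sub>C x) y = c *\<^sub>C odot N t x y"
proof -
  have "rank_one N (c *\<^sub>C x) (vac N) = (\<lambda>z. c *\<^sub>C rank_one N x (vac N) z)"
    by (simp add: rank_one_def rmul_scaleC_left)
  then show ?thesis
    using flow_endomorphism[OF assms] rank_one_adjointable
    by (simp add: odot_def unital_star_endomorphism_def)
qed

lemma bounded_bilinear_odot:
  assumes t: "t \<ge> 0"
  shows "bounded_bilinear (odot N t)"
proof
  have a: "flow N t (rank_one N x (vac N)) \<in> adjointables N" for x
    using t by (intro flow_adjointable rank_one_adjointable)
  have linear: "linear (flow N t (rank_one N x (vac N)))" for x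
    using bounded_linear.linear[OF adjointable_bounded_linear[OF a]] .
  show "odot N t x (y + y') = odot N t x y + odot N t x y'"
    and "odot N t x (r *\<^sub>R y) = r *\<^sub>R odot N t x y" for x y y' r
    using linear by (simp_all add: odot_def linear_add linear_scale)
  show "\<exists>K. \<forall>x y. norm (odot N t x y) \<le> norm x * norm y * K"
    using norm_odot_le[OF t] by blast
qed (simp_all add: odot_add_left odot_scaleC_left t scaleR_scaleC)

lemma ip_shift:
  assumes "t \<ge> 0"
  shows "ip N (odot N t x (vac N)) (odot N t y (vac N)) = ip N x y"
proof -
  have "rank_one N (vac N) x \<circ> rank_one N y (vac N)
      = rank_one N (rmul N (vac N) (ip N x y)) (vac N)"
    by (auto simp: rank_one_def ip_rmul_right rmul_rmul)
  then show ?thesis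
    using flow_is_adjoint[OF assms is_adjoint_rank_one] vac_flow[OF assms]
    by (simp add: odot_def is_adjoint_def flow_compose assms rank_one_adjointable)
qed

lemma norm_shift:
  assumes "t \<ge> 0"
  shows "norm (odot N t x (vac N)) = norm x"
proof -
  have "(norm (odot N t x (vac N)))\<^sup>2 = (norm x)\<^sup>2"
    using assms by (simp add: norm_ip ip_shift)
  then show ?thesis by simp
qed

text \<open>Both vectors have square \<open>1\<close>, and their inner product is \<open>1\<close> because the vacuum state is
  invariant, so their difference has square \<open>0\<close>.\<close>

lemma odot_vac_vac:
  assumes t: "t \<ge> 0"
  shows "odot N t (vac N) (vac N) = vac N"
proof -
  let ?x = "odot N t (vac N) (vac N)"
  have xv: "ip N (vac N) ?x = 1"
    using vac_flow[OF t, of 1] by (simp add: odot_def rmul_one)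
  then have "ip N ?x (vac N) = star 1"
    by (metis star_ip)
  also have "\<dots> = 1"
    using star_ip[of "vac N" "vac N"] by (simp add: vac_unit)
  finally have "ip N (?x - vac N) (?x - vac N) = 0"
    by (simp add: ip_diff_left ip_diff_right ip_shift t vac_unit xv)
  then show ?thesis
    using ip_self_eq_0 by fastforce
qed

lemma vac_in_fibre: "t \<ge> 0 \<Longrightarrow> vac N \<in> fibre N t"
  using odot_vac_vac unfolding fibre_def odot_def by (metis rangeI)

lemma odot_vac_fibre:
  assumes "t \<ge> 0" "y \<in> fibre N t"
  shows "odot N t (vac N) y = y"
proof -
  have "rank_one N (vac N) (vac N) \<circ> rank_one N (vac N) (vac N) = rank_one N (vac N) (vac N)"
    by (auto simp: rank_one_def ip_rmul_right vac_unit)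
  then show ?thesis
    using assms by (auto simp: fibre_def odot_def flow_compose rank_one_adjointable)
qed

lemma shift_continuous_subspace: "complex_vector.subspace (shift_continuous N)"
proof (rule complex_vector.subspaceI)
  show "0 \<in> shift_continuous N"
  proof -
    have "eventually (\<lambda>h. odot N h 0 (vac N) = 0) (at_right 0)"
      unfolding eventually_at_right_field
      by (intro exI[of _ 1]) (simp add: bounded_bilinear.zero_left[OF bounded_bilinear_odot])
    then show ?thesis
      by (simp add: shift_continuous_def tendsto_eventually)
  qed
next
  fix x y assume "x \<in> shift_continuous N" "y \<in> shift_continuous N"
  then have "((\<lambda>h. odot N h x (vac N) + odot N h y (vac N)) \<longlongrightarrow> x + y) (at_right 0)"
    by (auto simp: shift_continuous_def intro: tendsto_add)
  moreover have "eventually (\<lambda>h. odot N h x (vac N) + odot N h y (vac N) = odot N h (x + y) (vac N))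
      (at_right 0)"
    unfolding eventually_at_right_field by (intro exI[of _ 1]) (simp add: odot_add_left)
  ultimately show "x + y \<in> shift_continuous N"
    by (simp add: shift_continuous_def tendsto_cong)
next
  fix c x assume "x \<in> shift_continuous N"
  then have "((\<lambda>h. odot N h x (vac N) - x) \<longlongrightarrow> 0) (at_right 0)"
    by (simp add: shift_continuous_def LIM_zero)
  then have "((\<lambda>h. cmod c * norm (odot N h x (vac N) - x)) \<longlongrightarrow> 0) (at_right 0)"
    by (intro tendsto_mult_right_zero tendsto_norm_zero)
  moreover have "eventually (\<lambda>h. cmod c * norm (odot N h x (vac N) - x)
      = norm (odot N h (c *\<^sub>C x) (vac N) - c *\<^sub>C x)) (at_right 0)"
    unfolding eventually_at_right_field
    by (intro exI[of _ 1])
      (simp add: odot_scaleC_left norm_scaleC flip: complex_vector.scale_right_diff_distrib)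
  ultimately have "((\<lambda>h. norm (odot N h (c *\<^sub>C x) (vac N) - c *\<^sub>C x)) \<longlongrightarrow> 0) (at_right 0)"
    by (simp add: tendsto_cong)
  then show "c *\<^sub>C x \<in> shift_continuous N"
    by (simp add: shift_continuous_def LIM_zero_iff tendsto_norm_zero_iff)
qed

lemma shift_continuous_closed: "closed (shift_continuous N)"
proof -
  have "x \<in> shift_continuous N" if x: "x \<in> closure (shift_continuous N)" for x
    unfolding shift_continuous_def mem_Collect_eq
  proof (rule tendstoI)
    fix e :: real assume e: "e > 0"
    then obtain y where y: "y \<in> shift_continuous N" "dist y x < e / 3"
      using x closure_approachable[of x] by (meson divide_pos_pos zero_less_numeral)
    have "eventually (\<lambda>h. dist (odot N h y (vac N)) y < e / 3) (at_right 0)"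
      using y(1) e by (intro tendstoD) (simp_all add: shift_continuous_def)
    then show "eventually (\<lambda>h. dist (odot N h x (vac N)) x < e) (at_right 0)"
      using eventually_at_right_less[of "0::real"]
    proof eventually_elim
      case (elim h)
      have "dist (odot N h x (vac N)) (odot N h y (vac N)) = dist x y"
        using elim bounded_bilinear.diff_left[OF bounded_bilinear_odot, of h x y "vac N", symmetric]
        by (simp add: dist_norm norm_shift)
      then show ?case
        using elim y dist_triangle[of "odot N h x (vac N)" x "odot N h y (vac N)"]
          dist_triangle[of "odot N h y (vac N)" x y] by (simp add: dist_commute)
    qed
  qed
  then show ?thesis
    by (meson closure_subset closure_subset_eq subsetI)
qed

text \<open>Extending \<open>y\<close> by the vacuum on one side or on the other leads to the same fibre, at \<open>s + h\<close>,
  and associativity makes the two comparable inside products with \<open>x\<close>: it turns the difference of \<open>(x \<odot> y) \<odot> \<omega>\<^sub>h\<close> and \<open>(x \<odot> \<omega>\<^sub>h) \<odot> y\<close> into \<open>x \<odot> (y \<odot> \<omega>\<^sub>h - \<omega>\<^sub>h \<odot> y)\<close>, and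
  \<open>\<omega>\<^sub>h \<odot> y = y\<close> as elements of the module.\<close>

lemma shift_continuous_odot:
  assumes x: "x \<in> shift_continuous N" and y: "y \<in> shift_continuous N" "y \<in> fibre N s"
    and s: "s \<ge> 0"
  shows "odot N s x y \<in> shift_continuous N"
proof -
  let ?V = "\<lambda>h z. odot N h z (vac N)"
  have "((\<lambda>h. norm x * norm (?V h y - y) * (24 * norm (vac N))) \<longlongrightarrow> 0) (at_right 0)"
    using y(1) unfolding shift_continuous_def mem_Collect_eq
    by (intro tendsto_mult_left_zero tendsto_mult_right_zero tendsto_norm_zero LIM_zero)
  moreover have "eventually (\<lambda>h. norm (?V h (odot N s x y) - odot N s (?V h x) y)
      \<le> norm x * norm (?V h y - y) * (24 * norm (vac N))) (at_right 0)"
    using eventually_at_right_less[of "0::real"]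
  proof eventually_elim
    case (elim h)
    have "odot N s (?V h x) y = odot N (s + h) x y"
      using elim s y(2) by (simp add: odot_assoc odot_vac_fibre add.commute)
    moreover have "?V h (odot N s x y) = odot N (s + h) x (?V h y)"
      using elim s by (simp add: odot_assoc)
    ultimately have "?V h (odot N s x y) - odot N s (?V h x) y = odot N (s + h) x (?V h y - y)"
      using elim s by (simp add: bounded_bilinear.diff_right[OF bounded_bilinear_odot])
    then show ?case
      using elim s norm_odot_le[of "s + h"] by simp
  qed
  ultimately have "((\<lambda>h. ?V h (odot N s x y) - odot N s (?V h x) y) \<longlongrightarrow> 0) (at_right 0)"
    by (rule Lim_null_comparison[rotated])
  moreover have "((\<lambda>h. odot N s (?V h x) y) \<longlongrightarrow> odot N s x y) (at_right 0)"
    using x bounded_bilinear.tendsto[OF bounded_bilinear_odot[OF s] _ tendsto_const]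
    by (auto simp: shift_continuous_def)
  ultimately have "((\<lambda>h. (?V h (odot N s x y) - odot N s (?V h x) y) + odot N s (?V h x) y)
      \<longlongrightarrow> 0 + odot N s x y) (at_right 0)"
    by (rule tendsto_add)
  then show ?thesis
    by (simp add: shift_continuous_def)
qed

lemma shift_continuous_if_strongly_continuous:
  assumes "strongly_continuous N"
  shows "shift_continuous N = UNIV"
proof -
  have "((\<lambda>h. odot N h x (vac N)) \<longlongrightarrow> odot N 0 x (vac N)) (at 0 within {0..})" for x
    using assms rank_one_adjointable
    by (simp add: strongly_continuous_def odot_def continuous_on_def)
  moreover have "odot N 0 x (vac N) = x" for x
    by (simp add: odot_def flow_zero rank_one_adjointable) (simp add: rank_one_def vac_unit rmul_one)
  ultimately have "((\<lambda>h. odot N h x (vac N)) \<longlongrightarrow> x) (at_right 0)" for x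
    by (metis atLeast_iff greaterThan_iff less_imp_le subsetI tendsto_within_subset)
  then show ?thesis
    by (simp add: shift_continuous_def)
qed

text \<open>Write \<open>V\<^sub>h x = x \<odot> \<omega>\<^sub>h\<close> and \<open>h = \<bar>t - s\<bar>\<close>. The relation \<open>\<vartheta>\<^sub>h(a)V\<^sub>h = V\<^sub>ha\<close> gives
  \<open>\<vartheta>\<^sub>t(a)V\<^sub>h = V\<^sub>h\<vartheta>\<^sub>s(a)\<close> if \<open>s \<le> t\<close>, and the same with \<open>s\<close> and \<open>t\<close> exchanged otherwise. As \<open>V\<^sub>h\<close> is
  isometric, it can be cancelled in the second case. So the estimate is the same on both sides
  of \<open>s\<close>, although a one-parameter semigroup moves forward only.\<close>

lemma norm_flow_diff_le:
  fixes x :: 'e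
  assumes a: "a \<in> adjointables N" and st: "s \<ge> 0" "t \<ge> 0"
    and K: "\<And>r x. r \<ge> 0 \<Longrightarrow> norm (flow N r a x) \<le> K * norm x"
  defines "h \<equiv> \<bar>t - s\<bar>" and "z \<equiv> flow N s a x"
  shows "norm (flow N t a x - z)
    \<le> K * norm (odot N h x (vac N) - x) + norm (odot N h z (vac N) - z)"
proof -
  let ?V = "\<lambda>z. odot N h z (vac N)"
  have h: "h \<ge> 0"
    by (simp add: h_def)
  have flow_diff: "flow N r a (u - v) = flow N r a u - flow N r a v" if "r \<ge> 0" for r u v
    using bounded_linear.linear[OF adjointable_bounded_linear[OF flow_adjointable[OF that a]]]
    by (rule linear_diff)
  have V_flow: "flow N (r + h) a (?V x) = ?V (flow N r a x)" if "r \<ge> 0" for r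
    using flow_odot[OF h flow_adjointable[OF that a]] flow_add[OF h that a]
    by (simp add: add.commute)
  show ?thesis
  proof (cases "s \<le> t")
    case True
    then have "flow N t a x - z = flow N t a (x - ?V x) + (?V z - z)"
      using V_flow[OF st(1)] flow_diff[OF st(2)] by (simp add: h_def z_def)
    then have "norm (flow N t a x - z) \<le> norm (flow N t a (x - ?V x)) + norm (?V z - z)"
      by (simp only:) (rule norm_triangle_ineq)
    also have "\<dots> \<le> K * norm (x - ?V x) + norm (?V z - z)"
      using K[OF st(2)] by simp
    finally show ?thesis
      by (simp add: norm_minus_commute)
  next
    case False
    have "norm (flow N t a x - z) = norm (?V (flow N t a x - z))"
      using h by (simp add: norm_shift)
    also have "?V (flow N t a x - z) = flow N s a (?V x) - ?V z"
      using V_flow[OF st(2)] False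
      by (simp add: h_def bounded_bilinear.diff_left[OF bounded_bilinear_odot])
    also have "\<dots> = flow N s a (?V x - x) + (z - ?V z)"
      using flow_diff[OF st(1)] by (simp add: z_def)
    also have "norm \<dots> \<le> norm (flow N s a (?V x - x)) + norm (z - ?V z)"
      by (rule norm_triangle_ineq)
    also have "\<dots> \<le> K * norm (?V x - x) + norm (z - ?V z)"
      using K[OF st(1)] by simp
    finally show ?thesis
      by (simp add: norm_minus_commute)
  qed
qed

lemma strongly_continuous_if_shift_continuous:
  assumes "shift_continuous N = UNIV"
  shows "strongly_continuous N"
  unfolding strongly_continuous_def continuous_on_def
proof (intro ballI allI)
  fix a and x :: 'e and s :: real
  assume a: "a \<in> adjointables N" and "s \<in> {0..}"
  then have s: "s \<ge> 0" by simp
  obtain K where K: "\<And>y. norm (a y) \<le> K * norm y"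
    using adjointable_bound[OF a] by blast
  have K': "norm (flow N t a y) \<le> 6 * K * norm y" if "t \<ge> 0" for t y
    by (rule endomorphism_bound[OF flow_endomorphism[OF that] a K])
  let ?z = "flow N s a x"
  let ?d = "\<lambda>y h. norm (odot N h y (vac N) - y)"
  have "(?d y \<longlongrightarrow> 0) (at_right 0)" for y
  proof (intro tendsto_norm_zero LIM_zero)
    have "y \<in> shift_continuous N"
      using assms by simp
    then show "((\<lambda>h. odot N h y (vac N)) \<longlongrightarrow> y) (at_right 0)"
      by (simp add: shift_continuous_def)
  qed
  moreover have "filterlim (\<lambda>t. \<bar>t - s\<bar>) (at_right 0) (at s within {0..})"
  proof -
    have "((\<lambda>t. \<bar>t - s\<bar>) \<longlongrightarrow> \<bar>s - s\<bar>) (at s within {0..})"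
      by (intro tendsto_intros)
    then show ?thesis
      by (simp add: filterlim_at eventually_at_filter)
  qed
  ultimately have d: "((\<lambda>t. ?d y \<bar>t - s\<bar>) \<longlongrightarrow> 0) (at s within {0..})" for y
    using filterlim_compose by blast
  have "((\<lambda>t. 6 * K * ?d x \<bar>t - s\<bar> + ?d ?z \<bar>t - s\<bar>) \<longlongrightarrow> 0) (at s within {0..})"
    using tendsto_add[OF tendsto_mult_right_zero[OF d] d] by simp
  moreover have "eventually (\<lambda>t. norm (flow N t a x - ?z)
      \<le> 6 * K * ?d x \<bar>t - s\<bar> + ?d ?z \<bar>t - s\<bar>) (at s within {0..})"
    unfolding eventually_at_filter
    by (intro always_eventually allI impI norm_flow_diff_le[OF a s _ K']) simp_all
  ultimately have "((\<lambda>t. flow N t a x - ?z) \<longlongrightarrow> 0) (at s within {0..})"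
    by (rule Lim_null_comparison[rotated])
  then show "((\<lambda>t. flow N t a x) \<longlongrightarrow> ?z) (at s within {0..})"
    by (rule LIM_zero_cancel)
qed

end

section \<open>The product of two noises\<close>

lemma range_noise_embedding_shift_continuous:
  assumes N': "strict_weak_noise N'" "strongly_continuous N'"
    and N: "strict_weak_noise N"
    and j: "subsystem_embedding N' N j" and i: "noise_embedding N' N j i"
  shows "range i \<subseteq> shift_continuous N"
proof -
  interpret N': strict_weak_noise N' by fact
  interpret N: strict_weak_noise N by fact
  have iso: "module_isometry_on N' N UNIV i"
    using i by (simp add: noise_embedding_def)
  have i_diff: "i (x - y) = i x - i y" for x y
  proof -
    have "i (x - y + y) = i (x - y) + i y"
      using iso unfolding module_isometry_on_def by blast
    then show ?thesis by (simp add: algebra_simps)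
  qed
  have norm_i: "norm (i x) = norm x" for x
  proof -
    have "(norm (i x))\<^sup>2 = (norm x)\<^sup>2"
      using iso by (simp add: module_isometry_on_def N.norm_ip N'.norm_ip)
    then show ?thesis by simp
  qed
  have shift_i: "i (odot N' h x (vac N')) = odot N h (i x) (vac N)" if "h \<ge> 0" for h x
    using i j that N'.vac_in_fibre[OF that]
    by (simp add: noise_embedding_def subsystem_embedding_def)
  have "i x \<in> shift_continuous N" for x
  proof -
    have "((\<lambda>h. odot N' h x (vac N')) \<longlongrightarrow> x) (at_right 0)"
      using N'.shift_continuous_if_strongly_continuous[OF N'(2)]
      by (auto simp: shift_continuous_def)
    then have "((\<lambda>h. norm (odot N' h x (vac N') - x)) \<longlongrightarrow> 0) (at_right 0)"
      by (intro tendsto_norm_zero LIM_zero)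
    moreover have "eventually (\<lambda>h. norm (odot N' h x (vac N') - x)
        = norm (odot N h (i x) (vac N) - i x)) (at_right 0)"
      using eventually_at_right_less[of "0::real"]
      by eventually_elim (simp add: norm_i flip: shift_i i_diff)
    ultimately have "((\<lambda>h. norm (odot N h (i x) (vac N) - i x)) \<longlongrightarrow> 0) (at_right 0)"
      by (simp add: tendsto_cong)
    then show ?thesis
      by (simp add: shift_continuous_def LIM_zero_iff tendsto_norm_zero_iff)
  qed
  then show ?thesis by blast
qed

lemma subsystem_embedding_fibre:
  "subsystem_embedding N' N j \<Longrightarrow> t \<ge> 0 \<Longrightarrow> y \<in> fibre N' t \<Longrightarrow> j t y \<in> fibre N t"
  unfolding subsystem_embedding_def by blast

text \<open>The letters of the words in the product system therefore lie in the embedded factors. The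
  reason is that \<open>y = \<omega> \<odot> y\<close> on fibres, in the factor as well as in the product.\<close>

lemma subsystem_embedding_eq_noise_embedding:
  assumes N': "strict_weak_noise N'" and N: "strict_weak_noise N"
    and j: "subsystem_embedding N' N j" and i: "noise_embedding N' N j i"
    and t: "t \<ge> 0" and y: "y \<in> fibre N' t"
  shows "j t y = i y"
proof -
  have "i y = i (odot N' t (vac N') y)"
    using N' t y by (simp add: strict_weak_noise.odot_vac_fibre)
  also have "\<dots> = odot N t (vac N) (j t y)"
    using i t y by (simp add: noise_embedding_def)
  also have "\<dots> = j t y"
    using N t subsystem_embedding_fibre[OF j t y] by (rule strict_weak_noise.odot_vac_fibre)
  finally show ?thesis ..
qed

theorem theorem8p6:
  fixes N1 :: "('b::unital_cstar_algebra, 'e1::complex_banach) noise_data"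
    and N2 :: "('b, 'e2::complex_banach) noise_data"
    and N :: "('b, 'f::complex_banach) noise_data"
  assumes "strict_weak_noise N1" and "strongly_continuous N1"
    and "strict_weak_noise N2" and "strongly_continuous N2"
    and "is_noise_product N1 N2 N"
  shows "strongly_continuous N"
proof -
  obtain j1 j2 i1 i2 where N: "strict_weak_noise N"
    and product: "is_product_system N1 N2 N j1 j2"
    and i: "noise_embedding N1 N j1 i1" "noise_embedding N2 N j2 i2"
    and total: "closure (complex_vector.span
      {odot N t x y | t x y. t \<ge> 0 \<and> x \<in> range i1 \<union> range i2 \<and> y \<in> fibre N t}) = UNIV"
    using assms(5) unfolding is_noise_product_def by blast
  have j: "subsystem_embedding N1 N j1" "subsystem_embedding N2 N j2"
    and words_total: "\<And>t. t \<ge> 0 \<Longrightarrow> closure (complex_vector.span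
      {x. is_word N (\<lambda>s. j1 s ` fibre N1 s \<union> j2 s ` fibre N2 s) t x}) = fibre N t"
    using product unfolding is_product_system_def by blast+
  interpret strict_weak_noise N by fact
  let ?S = "shift_continuous N"
  have closure_span: "closure (complex_vector.span A) \<subseteq> ?S" if "A \<subseteq> ?S" for A
    using that shift_continuous_subspace shift_continuous_closed
    by (intro closure_minimal complex_vector.span_minimal)
  have ranges: "range i1 \<union> range i2 \<subseteq> ?S"
    using range_noise_embedding_shift_continuous assms N i j by (metis Un_least)
  have letter: "y \<in> ?S \<inter> fibre N t"
    if "t \<ge> 0" "y \<in> j1 t ` fibre N1 t \<union> j2 t ` fibre N2 t" for t y
  proof
    show "y \<in> fibre N t"
      using that subsystem_embedding_fibre[OF j(1)] subsystem_embedding_fibre[OF j(2)] by auto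
    have "y \<in> range i1 \<union> range i2"
      using that subsystem_embedding_eq_noise_embedding[OF assms(1) N j(1) i(1)]
        subsystem_embedding_eq_noise_embedding[OF assms(3) N j(2) i(2)] by auto
    then show "y \<in> ?S"
      using ranges by blast
  qed
  have word: "x \<in> ?S" if "is_word N (\<lambda>s. j1 s ` fibre N1 s \<union> j2 s ` fibre N2 s) t x" for t x
    using that by induction (use letter shift_continuous_odot in blast)+
  have fibre: "fibre N t \<subseteq> ?S" if "t \<ge> 0" for t
    using closure_span words_total[OF that] word by (metis (no_types, lifting) mem_Collect_eq subsetI)
  have "{odot N t x y | t x y. t \<ge> 0 \<and> x \<in> range i1 \<union> range i2 \<and> y \<in> fibre N t} \<subseteq> ?S"
    using shift_continuous_odot fibre ranges by blast
  then have "?S = UNIV"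
    using closure_span total by blast
  then show ?thesis
    by (rule strongly_continuous_if_shift_continuous)
qed

end
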